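(* Let $K\subset\mathbb{R}^2$ be a convex body contained in the interior of the closed unit disc $\mathbb{B}^2$ centered at the origin, and let $p\in\mathbb{R}^2$. Suppose that for every $x\in\mathbb{S}^1$ the line $L_x$, the bisector of the angle with vertex $x$ circumscribed to $K$, passes through $p$. Then $K$ is a disc with center at $p$.
   Context: A convex body in $\mathbb{R}^2$ is a compact convex set with non-empty interior. $\mathbb{S}^1$ is the unit circle centered at the origin. For $x\in\mathbb{R}^2\setminus K$, the solid cone generated by $K$ and $x$ is $\{x+\lambda(y-x) : y\in K,\ \lambda\ge 0\}$; in dimension 2 it is an angular region with vertex $x$ bounded by two rays lying on the two support lines of $K$ through $x$. $L_x$ denotes the full line through $x$ that bisects this angular region. *)

theory Defs
  imports "HOL-Analysis.Analysis"
begin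

definition convex_body :: "(real^2) set \<Rightarrow> bool" where
  "convex_body K \<longleftrightarrow> compact K \<and> convex K \<and> interior K \<noteq> {}"

definition solid_cone :: "(real^2) set \<Rightarrow> real^2 \<Rightarrow> (real^2) set" where
  "solid_cone K x = {x + l *\<^sub>R (y - x) | l y. y \<in> K \<and> 0 \<le> l}"

definition ray :: "real^2 \<Rightarrow> real^2 \<Rightarrow> (real^2) set" where
  "ray x u = {x + t *\<^sub>R u | t. 0 \<le> t}"

text \<open>The unoriented angle, in \<open>[0, pi]\<close>, between two nonzero vectors.\<close>

definition vec_angle :: "real^2 \<Rightarrow> real^2 \<Rightarrow> real" where
  "vec_angle u v = arccos ((u \<bullet> v) / (norm u * norm v))"

text \<open>The two rays with vertex \<open>x\<close> and unit directions \<open>u\<close>, \<open>v\<close> bound the angular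
  region \<open>solid_cone K x\<close>.\<close>

definition bounding_rays :: "(real^2) set \<Rightarrow> real^2 \<Rightarrow> real^2 \<Rightarrow> real^2 \<Rightarrow> bool" where
  "bounding_rays K x u v \<longleftrightarrow>
     norm u = 1 \<and> norm v = 1 \<and> u \<noteq> v \<and>
     frontier (solid_cone K x) = ray x u \<union> ray x v"

text \<open>The full line \<open>L\<^sub>x\<close>. For a convex body \<open>K\<close> and \<open>x \<notin> K\<close> the directions \<open>u\<close>, \<open>v\<close> exist
  and are unique up to swapping, and \<open>w\<close> exists and is unique up to a positive factor (it is a
  positive multiple of \<open>u + v\<close>), so the set below is exactly one line.\<close>

definition angle_bisector :: "(real^2) set \<Rightarrow> real^2 \<Rightarrow> (real^2) set" where
  "angle_bisector K x =
     {x + t *\<^sub>R w | t w. w \<noteq> 0 \<and> x + w \<in> solid_cone K x \<and>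
        (\<exists>u v. bounding_rays K x u v \<and> vec_angle u w = vec_angle w v)}"

end

theory Submission
  imports Defs
begin

text \<open>Follow a support line of \<open>K\<close> to its second endpoint on the unit circle, then take the other
  support line through that endpoint, and so on. The bisector condition says that along such an
  orbit all lines have the same signed distance \<open>h\<close> to \<open>p\<close>, so the orbit is a Poncelet orbit of a
  circle around \<open>p\<close>. If \<open>h\<close> vanished on some orbit, \<open>p\<close> would be equal to two consecutive
  vertices; hence \<open>h > 0\<close>. For the minimum \<open>m\<close> of \<open>h\<close>, the Poncelet map of \<open>sphere p m\<close> is a
  translation in the coordinate \<open>\<phi>\<close> given by its invariant measure. An orbit with \<open>h > m\<close> lags
  behind by a fixed amount of \<open>\<phi>\<close> per step, although the circle map of \<open>K\<close> preserves the cyclic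
  order of the two orbits. So \<open>h\<close> is constant and \<open>K\<close> has the support function of a disc.\<close>

section \<open>Unit vectors\<close>

definition dir :: "real \<Rightarrow> real^2" where
  "dir t = vector [cos t, sin t]"

lemma dir_nth [simp]: "dir t $ 1 = cos t" "dir t $ 2 = sin t"
  by (simp_all add: dir_def)

lemma inner_2: "x \<bullet> y = x $ 1 * y $ 1 + x $ 2 * y $ 2" for x y :: "real^2"
  by (simp add: inner_vec_def sum_2)

lemma vec_eq_2: "x = y \<longleftrightarrow> x $ 1 = y $ 1 \<and> x $ 2 = y $ 2" for x y :: "real^2"
  by (simp add: vec_eq_iff forall_2)

lemma inner_dir_dir: "dir s \<bullet> dir t = cos (s - t)"
  by (simp add: inner_2 cos_diff)

lemma norm_dir [simp]: "norm (dir t) = 1"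
  by (simp add: norm_eq_sqrt_inner inner_dir_dir)

lemma unit_vector_dir:
  fixes x :: "real^2"
  assumes "norm x = 1"
  obtains t where "0 \<le> t" "t \<le> 2 * pi" "x = dir t"
proof -
  have "(x $ 1)\<^sup>2 + (x $ 2)\<^sup>2 = 1"
    using assms by (simp add: norm_eq_1 inner_2 power2_eq_square)
  then obtain t where "0 \<le> t" "t < 2 * pi" "x $ 1 = cos t" "x $ 2 = sin t"
    using sincos_total_2pi by metis
  then show thesis using that[of t] by (simp add: vec_eq_2)
qed

lemma dir_add_2pi_nat: "dir (t + 2 * pi * real n) = dir t"
proof (induction n)
  case (Suc n)
  have "dir (t + 2 * pi * real (Suc n)) = dir ((t + 2 * pi * real n) + 2 * pi)"
    by (simp add: algebra_simps)
  also have "\<dots> = dir (t + 2 * pi * real n)"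
    by (simp only: vec_eq_2 dir_nth sin_periodic cos_periodic simp_thms)
  finally show ?case using Suc by simp
qed simp

text \<open>Orbits can be compared only when their starting parameters are ordered; this shifts the
  parameter of any normal beyond a given one.\<close>

lemma dir_beyond:
  obtains t' where "s \<le> t'" "dir t' = dir t"
proof -
  obtain n :: nat where n: "(s - t) / (2 * pi) \<le> real n" using real_arch_simple by blast
  then have "s \<le> t + 2 * pi * real n" by (simp add: field_simps)
  then show thesis using that dir_add_2pi_nat by blast
qed

lemma inner_dir_plus: "y \<bullet> dir (a + d) = cos d * (y \<bullet> dir a) + sin d * (y \<bullet> dir (a + pi/2))"
  by (simp add: inner_2 cos_add sin_add algebra_simps)

lemma norm_dir_frame: "(y \<bullet> dir t)\<^sup>2 + (y \<bullet> dir (t + pi/2))\<^sup>2 = (norm y)\<^sup>2"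
proof -
  have *: "y \<bullet> dir (t + pi/2) = y $ 2 * cos t - y $ 1 * sin t"
    unfolding inner_2 dir_nth cos_add sin_add by simp
  have "(norm y)\<^sup>2 = (y $ 1)\<^sup>2 + (y $ 2)\<^sup>2"
    unfolding power2_norm_eq_inner inner_2 by (simp add: power2_eq_square)
  moreover have "(y \<bullet> dir t)\<^sup>2 + (y $ 2 * cos t - y $ 1 * sin t)\<^sup>2
      = ((y $ 1)\<^sup>2 + (y $ 2)\<^sup>2) * ((sin t)\<^sup>2 + (cos t)\<^sup>2)"
    unfolding inner_2 dir_nth by algebra
  ultimately show ?thesis unfolding * by simp
qed

lemma DERIV_inner_dir:
  "((\<lambda>t. y \<bullet> dir t) has_real_derivative y \<bullet> dir (t + pi/2)) (at t)"
  unfolding inner_2 dir_nth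
  by (auto intro!: derivative_eq_intros simp: cos_add sin_add)

lemma inner_dir_zero_imp:
  assumes "y \<bullet> dir a = 0" "y \<bullet> dir b = 0" "sin (b - a) \<noteq> 0"
  shows "y = 0"
proof -
  have "y \<bullet> dir b = sin (b - a) * (y \<bullet> dir (a + pi/2))"
    using inner_dir_plus[of y a "b - a"] assms(1) by simp
  then have "y \<bullet> dir (a + pi/2) = 0" using assms by simp
  then have "(norm y)\<^sup>2 = 0" using norm_dir_frame[of y a] assms(1) by simp
  then show ?thesis by simp
qed

text \<open>The vectors orthogonal to \<open>dir a\<close> form the line spanned by
  \<open>dir (a + pi/2)\<close>. Hence \<open>u\<close> is plus or minus this vector, and the sign
  cancels because \<open>u\<close> occurs twice.\<close>

lemma orthogonal_dir_collinear:
  fixes z u :: "real^2"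
  assumes "z \<bullet> dir a = 0" "u \<bullet> dir a = 0" "norm u = 1"
  shows "z = (z \<bullet> u) *\<^sub>R u"
proof -
  define J where "J = dir (a + pi/2)"
  have ex: "y = (y \<bullet> J) *\<^sub>R J" if "y \<bullet> dir a = 0" for y
  proof -
    have "(y - (y \<bullet> J) *\<^sub>R J) \<bullet> J = 0"
      by (simp add: inner_diff_left J_def inner_dir_dir)
    moreover have "(y - (y \<bullet> J) *\<^sub>R J) \<bullet> dir a = 0"
      using that by (simp add: inner_diff_left J_def inner_dir_dir)
    ultimately show ?thesis
      using inner_dir_zero_imp[of "y - (y \<bullet> J) *\<^sub>R J" a "a + pi/2"] by (simp add: J_def)
  qed
  define c where "c = u \<bullet> J"
  have u: "u = c *\<^sub>R J" using ex[OF assms(2)] by (simp add: c_def)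
  then have "\<bar>c\<bar> = 1" using assms(3) by (simp add: J_def)
  then have "c * c = 1" by (metis abs_mult_self_eq mult_1)
  have "(z \<bullet> u) *\<^sub>R u = (c * c) *\<^sub>R ((z \<bullet> J) *\<^sub>R J)"
    by (simp add: u mult_ac)
  also have "\<dots> = z" using \<open>c * c = 1\<close> ex[OF assms(1)] by simp
  finally show ?thesis by simp
qed

text \<open>The derivative has absolute value \<open>|Q| / sqrt (1 - P^2)\<close>, where
  \<open>P\<close> and \<open>Q\<close> are the coordinates of \<open>y\<close> in the frame at
  \<open>u\<close>. It is below 1 since \<open>P^2 + Q^2 = (norm y)^2 < 1\<close>.\<close>

lemma arccos_inner_dir_Lipschitz:
  fixes y :: "real^2"
  assumes "norm y < 1" "s < t"
  shows "\<bar>arccos (y \<bullet> dir s) - arccos (y \<bullet> dir t)\<bar> < t - s"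
proof -
  have b: "\<bar>y \<bullet> dir u\<bar> < 1" for u
    using Cauchy_Schwarz_ineq2[of y "dir u"] assms(1) by simp
  have d: "\<bar>(y \<bullet> dir (u + pi/2)) / sqrt (1 - (y \<bullet> dir u)\<^sup>2)\<bar> < 1" for u
  proof -
    have "(norm y)\<^sup>2 < 1" using assms(1) by (simp add: abs_square_less_1)
    then have "(y \<bullet> dir (u + pi/2))\<^sup>2 < 1 - (y \<bullet> dir u)\<^sup>2" using norm_dir_frame[of y u] by linarith
    then have *: "\<bar>y \<bullet> dir (u + pi/2)\<bar> < sqrt (1 - (y \<bullet> dir u)\<^sup>2)"
      by (intro real_less_rsqrt) simp
    then have "0 < sqrt (1 - (y \<bullet> dir u)\<^sup>2)" by linarith
    then show ?thesis
      unfolding abs_divide using * by (simp only: abs_of_pos divide_less_eq_1_pos)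
  qed
  have D: "((\<lambda>u. arccos (y \<bullet> dir u)) has_real_derivative
      - ((y \<bullet> dir (u + pi/2)) / sqrt (1 - (y \<bullet> dir u)\<^sup>2))) (at u)" for u
  proof -
    have "-1 < y \<bullet> dir u" "y \<bullet> dir u < 1" using b[of u] by auto
    then have "((\<lambda>u. arccos (y \<bullet> dir u)) has_real_derivative
        inverse (- sqrt (1 - (y \<bullet> dir u)\<^sup>2)) * (y \<bullet> dir (u + pi/2))) (at u)"
      by (intro DERIV_chain2[where f = arccos and g = "\<lambda>u. y \<bullet> dir u"] DERIV_arccos DERIV_inner_dir)
    then show ?thesis by (rule DERIV_cong) (simp only: divide_inverse inverse_minus_eq mult_minus_left mult.commute)
  qed
  have "s - arccos (y \<bullet> dir s) < t - arccos (y \<bullet> dir t)"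
  proof (rule DERIV_pos_imp_increasing[OF assms(2)], intro exI conjI)
    fix u show "((\<lambda>u. u - arccos (y \<bullet> dir u)) has_real_derivative
      1 - - ((y \<bullet> dir (u + pi/2)) / sqrt (1 - (y \<bullet> dir u)\<^sup>2))) (at u)"
      by (intro DERIV_diff DERIV_ident D)
    show "0 < 1 - - ((y \<bullet> dir (u + pi/2)) / sqrt (1 - (y \<bullet> dir u)\<^sup>2))"
      using d[of u] by linarith
  qed
  moreover have "s + arccos (y \<bullet> dir s) < t + arccos (y \<bullet> dir t)"
  proof (rule DERIV_pos_imp_increasing[OF assms(2)], intro exI conjI)
    fix u show "((\<lambda>u. u + arccos (y \<bullet> dir u)) has_real_derivative
      1 + - ((y \<bullet> dir (u + pi/2)) / sqrt (1 - (y \<bullet> dir u)\<^sup>2))) (at u)"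
      by (intro DERIV_add DERIV_ident D)
    show "0 < 1 + - ((y \<bullet> dir (u + pi/2)) / sqrt (1 - (y \<bullet> dir u)\<^sup>2))"
      using d[of u] by linarith
  qed
  ultimately show ?thesis by linarith
qed

section \<open>The invariant measure of the Poncelet map of a circle\<close>

text \<open>The chord of the unit circle that is tangent to \<open>sphere p m\<close> with outward normal \<open>dir t\<close>
  has the endpoints \<open>dir (t - b)\<close> and \<open>dir (t + b)\<close> with \<open>cos b = m + p \<bullet> dir t\<close>. The tangent
  lengths from these endpoints are \<open>sin b * (1 - b')\<close> and \<open>sin b * (1 + b')\<close>, so the density
  \<open>1 / tangent length\<close> gives the same mass to the arcs cut off by all these chords.\<close>

lemma poncelet_measure:
  fixes p :: "real^2" and m :: real
  assumes m: "0 < m" "norm p + m < 1"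
  obtains \<phi> c where
    "\<And>x y. x \<le> y \<Longrightarrow> (y - x) / 2 \<le> \<phi> y - \<phi> x"
    "\<And>t. \<phi> (t + arccos (m + p \<bullet> dir t)) - \<phi> (t - arccos (m + p \<bullet> dir t)) = c"
proof -
  \<comment> \<open>The power of the point \<open>dir s\<close> with respect to
    \<open>sphere p m\<close>, that is, the squared tangent length.\<close>
  define G where "G s = (norm (dir s - p))\<^sup>2 - m\<^sup>2" for s
  have Gpos: "0 < G s" for s
  proof -
    have "m < norm (dir s - p)" using norm_triangle_ineq2[of "dir s" p] m by simp
    then show ?thesis using m by (simp add: G_def power_strict_mono)
  qed
  have Gle: "sqrt (G s) \<le> 2" for s
  proof -
    have "norm (dir s - p) \<le> 2" using norm_triangle_ineq4[of "dir s" p] m by simp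
    then have "(norm (dir s - p))\<^sup>2 \<le> 2\<^sup>2" by (intro power_mono) auto
    then have "G s \<le> 2\<^sup>2" unfolding G_def using zero_le_power2[of m] by linarith
    then show ?thesis by (simp add: real_le_lsqrt)
  qed
  have Geq: "G s = (1 - 2 * (p \<bullet> dir s) + (norm p)\<^sup>2) - m\<^sup>2" for s
    unfolding G_def power2_norm_eq_inner
    by (simp add: inner_diff_left inner_diff_right inner_commute inner_dir_dir)
  have contG: "isCont (\<lambda>s. 1 / sqrt (G s)) s" for s
    unfolding Geq using Gpos[of s, unfolded Geq]
    by (intro continuous_intros DERIV_isCont[OF DERIV_inner_dir]) auto
  obtain \<phi> where "\<And>x. (\<phi> has_vector_derivative 1 / sqrt (G x)) (at x)"
    using einterval_antiderivative[of "-\<infinity>" "\<infinity>" "\<lambda>s. 1 / sqrt (G s)"] contG by auto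
  then have D\<phi>: "(\<phi> has_real_derivative 1 / sqrt (G x)) (at x)" for x
    by (simp add: has_real_derivative_iff_has_vector_derivative)
  \<comment> \<open>Tangent lengths are at most 2, so the density is at least 1/2.\<close>
  have "(y - x) / 2 \<le> \<phi> y - \<phi> x" if "x \<le> y" for x y
  proof -
    have "\<phi> x - x/2 \<le> \<phi> y - y/2"
    proof (rule DERIV_nonneg_imp_nondecreasing[OF that], intro exI conjI)
      fix u show "((\<lambda>u. \<phi> u - u/2) has_real_derivative 1 / sqrt (G u) - 1/2) (at u)"
        by (intro DERIV_diff D\<phi>) (auto intro!: derivative_eq_intros)
      show "0 \<le> 1 / sqrt (G u) - 1/2" using Gle[of u] Gpos[of u] by (simp add: field_simps)
    qed
    then show ?thesis by (simp add: field_simps)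
  qed
  moreover
  define b where "b t = arccos (m + p \<bullet> dir t)" for t
  define q where "q t = p \<bullet> dir (t + pi/2)" for t
  have bd: "\<bar>m + p \<bullet> dir t\<bar> < 1" for t
    using Cauchy_Schwarz_ineq2[of p "dir t"] m by simp
  have cosb: "cos (b t) = m + p \<bullet> dir t" for t
    unfolding b_def using bd[of t] by (intro cos_arccos) auto
  have sinb: "sin (b t) = sqrt (1 - (m + p \<bullet> dir t)\<^sup>2)" for t
    unfolding b_def using bd[of t] by (intro sin_arccos) auto
  have sinpos: "0 < sin (b t)" for t
    using bd[of t] unfolding sinb by (simp add: abs_square_less_1)
  \<comment> \<open>The tangent point \<open>p + m *\<^sub>R dir t\<close> has coordinate
    \<open>q t\<close> along the chord, measured from its midpoint, and \<open>sin (b t)\<close> is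
    the half-length: the chord is touched strictly between its endpoints.\<close>
  have qb: "\<bar>q t\<bar> < sin (b t)" for t
  proof -
    have pd: "p \<bullet> dir t \<le> norm p" using Cauchy_Schwarz_ineq2[of p "dir t"] by simp
    have "(norm p + m)\<^sup>2 < 1" using m by (simp add: abs_square_less_1)
    moreover have "m * (p \<bullet> dir t) \<le> m * norm p" using pd m by simp
    ultimately have "(q t)\<^sup>2 < 1 - (m + p \<bullet> dir t)\<^sup>2"
      using norm_dir_frame[of p t] unfolding q_def by (simp add: power2_sum algebra_simps)
    then show ?thesis unfolding sinb by (intro real_less_rsqrt) simp
  qed
  have Db: "(b has_real_derivative - (q t / sin (b t))) (at t)" for t
  proof -
    have "-1 < m + p \<bullet> dir t" "m + p \<bullet> dir t < 1" using bd[of t] by auto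
    then have "((\<lambda>t. arccos (m + p \<bullet> dir t)) has_real_derivative
        inverse (- sqrt (1 - (m + p \<bullet> dir t)\<^sup>2)) * (0 + p \<bullet> dir (t + pi/2))) (at t)"
      by (intro DERIV_chain2[where f = arccos and g = "\<lambda>t. m + p \<bullet> dir t"]
          DERIV_arccos DERIV_inner_dir DERIV_add DERIV_const)
    then show ?thesis
      unfolding b_def[abs_def] sinb[unfolded b_def] q_def
      by (rule DERIV_cong)
        (simp only: divide_inverse inverse_minus_eq mult_minus_left mult.commute add_0)
  qed
  \<comment> \<open>This makes \<open>G\<close> a perfect square at both endpoints, with
    \<open>P = p \<bullet> dir t\<close>, \<open>s = sin (b t)\<close> and \<open>k\<close> equal to
    \<open>q t\<close> or \<open>- q t\<close>.\<close>
  have poly: "1 - 2 * e + N - m\<^sup>2 = (s - k)\<^sup>2"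
    if "e = (m + P) * P + s * k" "s\<^sup>2 + (m + P)\<^sup>2 = 1" "P\<^sup>2 + k\<^sup>2 = N" for e s k P N :: real
    using that by (simp add: power2_eq_square algebra_simps)
  have Gplus: "sqrt (G (t + b t)) = sin (b t) - q t" for t
  proof -
    have "G (t + b t) = (sin (b t) - q t)\<^sup>2"
      using poly[of "p \<bullet> dir (t + b t)" "p \<bullet> dir t" "sin (b t)" "q t" "(norm p)\<^sup>2"] norm_dir_frame[of p t] cosb[of t]
        sin_cos_squared_add[of "b t"] inner_dir_plus[of p t "b t"]
      unfolding Geq by (simp add: q_def)
    then show ?thesis using qb[of t] by simp
  qed
  have Gminus: "sqrt (G (t - b t)) = sin (b t) + q t" for t
  proof -
    have "G (t - b t) = (sin (b t) + q t)\<^sup>2"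
      using poly[of "p \<bullet> dir (t - b t)" "p \<bullet> dir t" "sin (b t)" "- q t" "(norm p)\<^sup>2"] norm_dir_frame[of p t] cosb[of t]
        sin_cos_squared_add[of "b t"] inner_dir_plus[of p t "- b t"]
      unfolding Geq by (simp add: q_def)
    then show ?thesis using qb[of t] by simp
  qed
  \<comment> \<open>Density times endpoint speed is \<open>1 / sin (b t)\<close> at either end, so
    the mass gained in front equals the mass lost behind.\<close>
  have "((\<lambda>t. \<phi> (t + b t) - \<phi> (t - b t)) has_real_derivative 0) (at t)" for t
  proof -
    have "((\<lambda>t. \<phi> (t + b t)) has_real_derivative
        1 / sqrt (G (t + b t)) * (1 + - (q t / sin (b t)))) (at t)"
      by (rule DERIV_chain2[OF D\<phi>]) (intro DERIV_add DERIV_ident Db)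
    moreover have "((\<lambda>t. \<phi> (t - b t)) has_real_derivative
        1 / sqrt (G (t - b t)) * (1 - - (q t / sin (b t)))) (at t)"
      by (rule DERIV_chain2[OF D\<phi>]) (intro DERIV_diff DERIV_ident Db)
    ultimately have "((\<lambda>t. \<phi> (t + b t) - \<phi> (t - b t)) has_real_derivative
        1 / sqrt (G (t + b t)) * (1 + - (q t / sin (b t)))
        - 1 / sqrt (G (t - b t)) * (1 - - (q t / sin (b t)))) (at t)"
      by (rule DERIV_diff)
    moreover have "1 / sqrt (G (t + b t)) * (1 + - (q t / sin (b t))) = 1 / sin (b t)"
      unfolding Gplus using qb[of t] sinpos[of t] by (simp add: field_simps)
    moreover have "1 / sqrt (G (t - b t)) * (1 - - (q t / sin (b t))) = 1 / sin (b t)"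
      unfolding Gminus using qb[of t] sinpos[of t] by (simp add: field_simps)
    ultimately show ?thesis by simp
  qed
  then have "\<phi> (t + b t) - \<phi> (t - b t) = \<phi> (0 + b 0) - \<phi> (0 - b 0)" for t
    using DERIV_isconst_all[of "\<lambda>t. \<phi> (t + b t) - \<phi> (t - b t)" t 0] by blast
  ultimately show thesis using that unfolding b_def by blast
qed

section \<open>Support lines and the circumscribed chord map\<close>

definition supp :: "(real^2) set \<Rightarrow> real^2 \<Rightarrow> real" where
  "supp K n = (SUP y\<in>K. y \<bullet> n)"

text \<open>The support line with outward normal \<open>dir t\<close> cuts the unit circle in
  \<open>dir (t - half_width K t)\<close> and \<open>dir (t + half_width K t)\<close>.\<close>

definition half_width :: "(real^2) set \<Rightarrow> real \<Rightarrow> real" where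
  "half_width K t = arccos (supp K (dir t))"

locale bisected_body =
  fixes K :: "(real^2) set" and p :: "real^2"
  assumes body: "convex_body K"
    and in_ball: "K \<subseteq> ball 0 1"
    and bisector: "\<And>x. norm x = 1 \<Longrightarrow> p \<in> angle_bisector K x"
begin

abbreviation "\<beta> \<equiv> half_width K"

definition h :: "real \<Rightarrow> real" where
  "h t = supp K (dir t) - p \<bullet> dir t"

lemma compact_K: "compact K" and convex_K: "convex K" and interior_K: "interior K \<noteq> {}"
  using body by (auto simp: convex_body_def)

lemma nonempty_K: "K \<noteq> {}"
  using interior_K interior_subset by blast

lemma support_point: obtains y where "y \<in> K" "y \<bullet> n = supp K n"
proof -
  have "compact ((\<lambda>y. y \<bullet> n) ` K)"
    by (intro compact_continuous_image compact_K continuous_intros)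
  then obtain y where "y \<in> K" "\<forall>z\<in>K. z \<bullet> n \<le> y \<bullet> n"
    using compact_attains_sup[of "(\<lambda>y. y \<bullet> n) ` K"] nonempty_K by auto
  then have "supp K n = y \<bullet> n"
    unfolding supp_def by (intro cSup_eq_maximum) auto
  then show thesis using that \<open>y \<in> K\<close> by simp
qed

lemma supp_upper: assumes "y \<in> K" shows "y \<bullet> n \<le> supp K n"
proof -
  have "compact ((\<lambda>y. y \<bullet> n) ` K)"
    by (intro compact_continuous_image compact_K continuous_intros)
  then show ?thesis
    unfolding supp_def using assms
    by (intro cSup_upper) (auto intro: bounded_imp_bdd_above compact_imp_bounded)
qed

lemma abs_supp_less: "\<bar>supp K (dir t)\<bar> < 1"
proof -
  obtain y where y: "y \<in> K" "y \<bullet> dir t = supp K (dir t)" using support_point .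
  then have "norm y < 1" using in_ball by auto
  then show ?thesis using Cauchy_Schwarz_ineq2[of y "dir t"] y by simp
qed

lemma cos_half_width: "cos (\<beta> t) = supp K (dir t)"
  unfolding half_width_def using abs_supp_less[of t] by (intro cos_arccos) auto

lemma half_width_bounds: "0 < \<beta> t" "\<beta> t < pi"
  unfolding half_width_def using abs_supp_less[of t] arccos_lt_bounded[of "supp K (dir t)"] by auto

text \<open>\<beta> is the minimum of \<open>arccos (y \<bullet> dir t)\<close> over
  \<open>y\<close> in \<open>K\<close>. A point that attains it at one parameter bounds it at the
  other. Strictness makes both chord endpoints strictly increasing in \<open>t\<close>.\<close>

lemma half_width_Lipschitz: assumes "s < t" shows "\<bar>\<beta> s - \<beta> t\<bar> < t - s"
proof -
  have key: "\<beta> v - \<beta> u < t - s" if "{u, v} = {s, t}" for u v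
  proof -
    obtain y where y: "y \<in> K" "y \<bullet> dir u = supp K (dir u)" using support_point .
    then have n: "norm y < 1" using in_ball by auto
    then have "\<bar>y \<bullet> dir v\<bar> \<le> 1" using Cauchy_Schwarz_ineq2[of y "dir v"] by simp
    then have "\<beta> v \<le> arccos (y \<bullet> dir v)"
      unfolding half_width_def using supp_upper[OF y(1)] abs_supp_less[of v]
      by (intro arccos_le_arccos) auto
    moreover have "\<beta> u = arccos (y \<bullet> dir u)" using y by (simp add: half_width_def)
    ultimately show ?thesis
      using arccos_inner_dir_Lipschitz[OF n assms] that by (auto simp: doubleton_eq_iff)
  qed
  show ?thesis using key[of s t] key[of t s] by (auto simp: insert_commute abs_less_iff)
qed

lemma continuous_half_width: "continuous_on A \<beta>"
proof -
  have "dist (\<beta> s) (\<beta> t) \<le> dist s t" for s t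
    using half_width_Lipschitz[of s t] half_width_Lipschitz[of t s]
    by (cases s t rule: linorder_cases) (auto simp: dist_real_def)
  then show ?thesis
    unfolding continuous_on_iff by (meson le_less_trans)
qed

lemma continuous_h: "continuous_on A h"
  unfolding h_def[abs_def] cos_half_width[symmetric] inner_2 dir_nth
  by (intro continuous_intros continuous_half_width)

lemma strict_mono_left: "s < t \<Longrightarrow> s - \<beta> s < t - \<beta> t"
  and strict_mono_right: "s < t \<Longrightarrow> s + \<beta> s < t + \<beta> t"
  using half_width_Lipschitz[of s t] by auto

text \<open>\<open>F a\<close> is the normal of the second support line through the endpoint \<open>dir (a + \<beta> a)\<close> of
  the chord with normal \<open>dir a\<close>.\<close>

definition F :: "real \<Rightarrow> real" where
  "F a = (SOME a'. a' - \<beta> a' = a + \<beta> a)"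

text \<open>Since \<beta> lies between 0 and \<open>pi\<close>, the continuous function
  \<open>x - \<beta> x\<close> passes the value \<open>?c\<close> between \<open>?c\<close> and
  \<open>?c + pi\<close>.\<close>

lemma F: "F a - \<beta> (F a) = a + \<beta> a"
proof -
  let ?c = "a + \<beta> a"
  have "continuous_on {?c..?c + pi} (\<lambda>x. x - \<beta> x)"
    by (intro continuous_on_diff continuous_on_id continuous_half_width)
  moreover have "?c - \<beta> ?c \<le> ?c" "?c \<le> ?c + pi - \<beta> (?c + pi)" "?c \<le> ?c + pi"
    using half_width_bounds(1)[of ?c] half_width_bounds(2)[of "?c + pi"] by auto
  ultimately have "\<exists>x. x - \<beta> x = ?c"
    using IVT'[of "\<lambda>x. x - \<beta> x" ?c ?c "?c + pi"] by blast
  then show ?thesis unfolding F_def by (rule someI_ex)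
qed

lemma F_mono: assumes "a \<le> b" shows "F a \<le> F b"
proof (rule ccontr)
  assume "\<not> F a \<le> F b"
  then have "b + \<beta> b < a + \<beta> a" using strict_mono_left[of "F b" "F a"] F[of a] F[of b] by simp
  then show False using strict_mono_right[of a b] assms by (cases "a = b") auto
qed

section \<open>Bisectors of the circumscribed angles and the invariance of \<open>h\<close>\<close>

text \<open>The support line meets \<open>K\<close> at some point ahead of \<open>x\<close>, so the
  ray lies in the cone; it also lies on the boundary of a half-plane containing the cone.\<close>

lemma support_ray:
  assumes "norm x = 1" "x \<bullet> dir a = supp K (dir a)"
    and "norm u = 1" "u \<bullet> dir a = 0" "x \<bullet> u < 0"
  shows "ray x u \<subseteq> frontier (solid_cone K x)"
proof
  fix z assume "z \<in> ray x u"
  then obtain t where t: "0 \<le> t" "z = x + t *\<^sub>R u" by (auto simp: ray_def)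
  obtain y where y: "y \<in> K" "y \<bullet> dir a = supp K (dir a)" using support_point .
  define l where "l = (y - x) \<bullet> u"
  have yx: "y - x = l *\<^sub>R u"
    unfolding l_def using assms y
    by (intro orthogonal_dir_collinear[of _ a]) (auto simp: inner_diff_left)
  \<comment> \<open>\<open>x \<bullet> u < 0\<close> means that \<open>u\<close> points into the
    disc; going backwards from \<open>x\<close> would leave the disc, but \<open>y\<close> is inside
    it.\<close>
  have "l > 0"
  proof (rule ccontr)
    assume "\<not> l > 0"
    then have "0 \<le> l * (x \<bullet> u)" using assms(5) by (simp add: mult_nonpos_nonpos)
    moreover have "y = x + l *\<^sub>R u" using yx by (simp add: algebra_simps)
    then have "(norm y)\<^sup>2 = (norm x)\<^sup>2 + 2 * (l * (x \<bullet> u)) + l\<^sup>2 * (norm u)\<^sup>2"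
      unfolding power2_norm_eq_inner
      by (simp add: inner_add_left inner_add_right inner_commute power2_eq_square)
    ultimately have "1 \<le> (norm y)\<^sup>2" using assms by simp
    moreover have "norm y < 1" using y in_ball by auto
    then have "(norm y)\<^sup>2 < 1" by (simp add: abs_square_less_1)
    ultimately show False by simp
  qed
  then have "z = x + (t / l) *\<^sub>R (y - x)" "0 \<le> t / l" using t yx by auto
  then have "z \<in> solid_cone K x" unfolding solid_cone_def using y by blast
  moreover have "z \<notin> interior (solid_cone K x)"
  proof
    assume "z \<in> interior (solid_cone K x)"
    moreover have "solid_cone K x \<subseteq> {w. dir a \<bullet> w \<le> supp K (dir a)}"
    proof
      fix w assume "w \<in> solid_cone K x"
      then obtain k y' where w: "w = x + k *\<^sub>R (y' - x)" "y' \<in> K" "0 \<le> k"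
        by (auto simp: solid_cone_def)
      have "k * (y' \<bullet> dir a - x \<bullet> dir a) \<le> 0"
        using supp_upper[OF w(2), of "dir a"] assms(2) w(3) by (simp add: mult_nonneg_nonpos)
      then show "w \<in> {w. dir a \<bullet> w \<le> supp K (dir a)}"
        using assms(2) by (simp add: w inner_add_right inner_diff_right inner_commute)
    qed
    ultimately have "z \<in> interior {w. dir a \<bullet> w \<le> supp K (dir a)}"
      using interior_mono by blast
    moreover have "dir a \<noteq> 0" using norm_dir[of a] by force
    ultimately have "dir a \<bullet> z < supp K (dir a)" by simp
    then show False using assms t by (simp add: inner_add_right inner_commute)
  qed
  ultimately show "z \<in> frontier (solid_cone K x)"
    unfolding frontier_def using closure_subset by blast
qed

text \<open>A turn by \<open>pi\<close> would make two opposite support lines coincide, confining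
  \<open>K\<close> to a line against its non-empty interior.\<close>

lemma step_bounds: "0 < F a - a" "F a - a < 2 * pi" "F a - a \<noteq> pi"
proof -
  have eq: "F a - a = \<beta> a + \<beta> (F a)" using F[of a] by simp
  show "0 < F a - a" "F a - a < 2 * pi"
    using eq half_width_bounds[of a] half_width_bounds[of "F a"] by auto
  show "F a - a \<noteq> pi"
  proof
    assume pi: "F a - a = pi"
    then have F': "F a = a + pi" by simp
    have opp: "dir (F a) = - dir a" unfolding F' by (simp add: vec_eq_2)
    have "\<beta> (F a) = pi - \<beta> a" using eq pi by simp
    then have s: "supp K (- dir a) = - supp K (dir a)"
      using cos_half_width[of "F a"] cos_half_width[of a] opp by (simp add: cos_diff)
    have "y \<bullet> dir a = supp K (dir a)" if "y \<in> K" for y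
      using supp_upper[OF that, of "dir a"] supp_upper[OF that, of "- dir a"] s by simp
    then have "K \<subseteq> {y. dir a \<bullet> y = supp K (dir a)}" by (auto simp: inner_commute)
    then have "interior K \<subseteq> interior {y. dir a \<bullet> y = supp K (dir a)}" by (rule interior_mono)
    moreover have "dir a \<noteq> 0" using norm_dir[of a] by force
    ultimately show False using interior_K by (simp add: interior_hyperplane)
  qed
qed

lemma sin_step: "sin (F a - a) \<noteq> 0"
  using step_bounds[of a] sin_gt_zero[of "F a - a"] sin_lt_zero[of "F a - a"]
  by (cases "F a - a < pi") auto

text \<open>The two support rays at the vertex are the bounding rays, up to order. Equal angles with
  unit vectors then mean equal inner products with the direction of the bisector.\<close>

lemma bisector_perp:
  defines "x a \<equiv> dir (a + \<beta> a)"
  shows "(p - x a) \<bullet> (dir (a - pi/2) - dir (F a + pi/2)) = 0"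
proof -
  define u0 v0 where "u0 = dir (a - pi/2)" and "v0 = dir (F a + pi/2)"
  have x': "x a = dir (F a - \<beta> (F a))" using F[of a] by (simp add: x_def)
  have sb: "0 < sin (\<beta> t)" for t using half_width_bounds[of t] by (intro sin_gt_zero) auto
  have r1: "ray (x a) u0 \<subseteq> frontier (solid_cone K (x a))"
    by (rule support_ray[where a = a])
      (use sb[of a] in \<open>auto simp: x_def u0_def inner_dir_dir cos_half_width cos_add\<close>)
  have r2: "ray (x a) v0 \<subseteq> frontier (solid_cone K (x a))"
    by (rule support_ray[where a = "F a"])
      (use sb[of "F a"] in \<open>auto simp: x' v0_def inner_dir_dir cos_half_width cos_diff sin_diff\<close>)
  have ne: "u0 \<noteq> v0"
  proof
    assume "u0 = v0"
    then have "v0 \<bullet> dir a = u0 \<bullet> dir a" by simp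
    also have "u0 \<bullet> dir a = 0" by (simp add: u0_def inner_dir_dir)
    also have "v0 \<bullet> dir a = cos ((F a - a) + pi/2)"
      by (simp add: v0_def inner_dir_dir algebra_simps)
    finally have "sin (F a - a) = 0" by (simp add: cos_add)
    then show False using sin_step[of a] by simp
  qed
  have "p \<in> angle_bisector K (x a)" by (rule bisector) (simp add: x_def)
  then obtain t w u v where p: "p = x a + t *\<^sub>R w" and w: "w \<noteq> 0"
    and uv: "bounding_rays K (x a) u v" and ang: "vec_angle u w = vec_angle w v"
    unfolding angle_bisector_def by blast
  have nuv: "norm u = 1" "norm v = 1"
    and fr: "frontier (solid_cone K (x a)) = ray (x a) u \<union> ray (x a) v"
    using uv by (auto simp: bounding_rays_def)
  \<comment> \<open>The point at parameter 1 makes \<open>d\<close> a nonnegative multiple of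
    \<open>u\<close> or \<open>v\<close>; as all three are unit vectors, the factor is 1.\<close>
  have in_uv: "d = u \<or> d = v" if "ray (x a) d \<subseteq> ray (x a) u \<union> ray (x a) v" "norm d = 1" for d
  proof -
    have "x a + 1 *\<^sub>R d \<in> ray (x a) d" unfolding ray_def using zero_le_one by blast
    then have "x a + d \<in> ray (x a) u \<union> ray (x a) v" using that(1) by auto
    then obtain k e where k: "0 \<le> k" "d = k *\<^sub>R e" "e = u \<or> e = v"
      unfolding ray_def by fastforce
    then have "k = 1" using that(2) nuv by auto
    then show ?thesis using k by auto
  qed
  have "u0 = u \<or> u0 = v" "v0 = u \<or> v0 = v"
    using in_uv r1 r2 fr by (auto simp: u0_def v0_def)
  then have cases: "u0 = u \<and> v0 = v \<or> u0 = v \<and> v0 = u" using ne by auto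
  have "\<bar>(u \<bullet> w) / norm w\<bar> \<le> 1" "\<bar>(w \<bullet> v) / norm w\<bar> \<le> 1"
    using Cauchy_Schwarz_ineq2[of u w] Cauchy_Schwarz_ineq2[of w v] nuv w by simp_all
  then have "(u \<bullet> w) / norm w = (w \<bullet> v) / norm w"
    using ang arccos_eq_iff[of "(u \<bullet> w) / norm w" "(w \<bullet> v) / norm w"] nuv
    by (simp add: vec_angle_def)
  then have "u \<bullet> w = v \<bullet> w" using w by (simp add: inner_commute)
  then have "w \<bullet> (u0 - v0) = 0" using cases by (auto simp: inner_diff_right inner_commute)
  then show ?thesis using p by (simp add: u0_def v0_def)
qed

text \<open>The line \<open>L\<^sub>x\<close> consists of the points with equal signed distances to the two support lines
  through \<open>x\<close>; \<open>h\<close> is this signed distance for \<open>p\<close>.\<close>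

lemma h_F: "h (F a) = h a"
proof -
  define x where "x = dir (a + \<beta> a)"
  define \<delta> where "\<delta> = (F a - a) / 2"
  define c where "c = a + \<delta>"
  have x1: "x \<bullet> dir a = supp K (dir a)"
    by (simp add: x_def inner_dir_dir cos_half_width)
  have "x = dir (F a - \<beta> (F a))" using F[of a] by (simp add: x_def)
  then have x2: "x \<bullet> dir (F a) = supp K (dir (F a))"
    by (simp add: inner_dir_dir cos_half_width)
  have ca: "a = c + - \<delta>" "F a = c + \<delta>" by (simp_all add: c_def \<delta>_def field_simps)
  \<comment> \<open>Here \<open>dir c\<close> is the middle of the two normals. The bisector
    condition thus kills the component of \<open>p - x\<close> along \<open>dir (c + pi/2)\<close>,
    and the rest pairs equally with \<open>dir (c - \<delta>)\<close> and
    \<open>dir (c + \<delta>)\<close>.\<close>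
  have "dir (c + - \<delta> - pi/2) - dir (c + \<delta> + pi/2) = (- 2 * cos \<delta>) *\<^sub>R dir (c + pi/2)"
    by (simp add: vec_eq_2 cos_add sin_add cos_diff sin_diff)
  then have d: "dir (a - pi/2) - dir (F a + pi/2) = (- 2 * cos \<delta>) *\<^sub>R dir (c + pi/2)"
    by (simp only: ca[symmetric])
  have "cos \<delta> \<noteq> 0"
  proof
    assume "cos \<delta> = 0"
    then have "sin (2 * \<delta>) = 0" by (simp add: sin_double)
    moreover have "2 * \<delta> = F a - a" by (simp add: \<delta>_def)
    ultimately show False using sin_step[of a] by simp
  qed
  moreover have "(p - x) \<bullet> ((- 2 * cos \<delta>) *\<^sub>R dir (c + pi/2)) = 0"
    using bisector_perp[of a] unfolding d x_def .
  ultimately have z: "(p - x) \<bullet> dir (c + pi/2) = 0" by simp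
  have "(p - x) \<bullet> dir a = (p - x) \<bullet> dir (F a)"
    using inner_dir_plus[of "p - x" c "- \<delta>"] inner_dir_plus[of "p - x" c \<delta>] z
    by (simp only: ca[symmetric]) simp
  then show ?thesis using x1 x2 by (simp add: h_def inner_diff_left)
qed

section \<open>Positivity of \<open>h\<close>\<close>

lemma h_nonzero: "h a \<noteq> 0"
proof
  \<comment> \<open>By invariance \<open>p\<close> lies on both support lines through the vertex,
    and these are not parallel.\<close>
  have eq: "p = dir (t + \<beta> t)" if "h t = 0" for t
  proof -
    define x where "x = dir (t + \<beta> t)"
    have x1: "x \<bullet> dir t = supp K (dir t)"
      by (simp add: x_def inner_dir_dir cos_half_width)
    have "x = dir (F t - \<beta> (F t))" using F[of t] by (simp add: x_def)
    then have x2: "x \<bullet> dir (F t) = supp K (dir (F t))"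
      by (simp add: inner_dir_dir cos_half_width)
    have "sin (F t - t) \<noteq> 0" by (rule sin_step)
    moreover have "(p - x) \<bullet> dir t = 0" "(p - x) \<bullet> dir (F t) = 0"
      using that h_F[of t] x1 x2 by (auto simp: h_def inner_diff_left)
    ultimately have "p - x = 0" using inner_dir_zero_imp by blast
    then show ?thesis by (simp add: x_def)
  qed
  assume "h a = 0"
  then have "p = dir (F a - \<beta> (F a))" "p = dir (F a + \<beta> (F a))"
    using eq[of a] eq[of "F a"] h_F[of a] F[of a] by auto
  \<comment> \<open>The endpoints of one chord coincide only if
    \<open>cos (2 * \<beta> (F a)) = 1\<close>.\<close>
  then have "sin (\<beta> (F a)) * sin (\<beta> (F a)) = 0"
    using inner_dir_dir[of "F a - \<beta> (F a)" "F a + \<beta> (F a)"] inner_dir_dir[of "F a - \<beta> (F a)" "F a - \<beta> (F a)"]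
    by (simp add: cos_double_sin power2_eq_square flip: mult_2)
  then show False using half_width_bounds[of "F a"] sin_gt_zero[of "\<beta> (F a)"] by simp
qed

text \<open>\<open>h a + h (a + pi)\<close> is the width of \<open>K\<close>, so a negative value
  would force a zero of \<open>h\<close> by continuity.\<close>

lemma h_pos: "0 < h a"
proof (rule ccontr)
  assume "\<not> 0 < h a"
  then have neg: "h a < 0" using h_nonzero[of a] by simp
  obtain y where "y \<in> K" using nonempty_K by blast
  have "dir (a + pi) = - dir a" by (simp add: vec_eq_2)
  then have "0 \<le> h a + h (a + pi)"
    using supp_upper[OF \<open>y \<in> K\<close>, of "dir a"] supp_upper[OF \<open>y \<in> K\<close>, of "- dir a"]
    by (simp add: h_def)
  then have "0 \<le> h (a + pi)" using neg by simp
  then have "\<exists>x\<ge>a. x \<le> a + pi \<and> h x = 0"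
    using neg IVT'[of h a 0 "a + pi"] continuous_h by simp
  then show False using h_nonzero by blast
qed

section \<open>Comparison of two orbits and the disc\<close>

lemma h_not_greater:
  assumes "a \<le> b" "norm p + h a < 1"
  shows "h b \<le> h a"
proof (rule ccontr)
  assume less: "\<not> h b \<le> h a"
  define m where "m = h a"
  define d where "d = h b - m"
  have "d > 0" using less by (simp add: d_def m_def)
  obtain \<phi> c where \<phi>: "\<And>x y. x \<le> y \<Longrightarrow> (y - x) / 2 \<le> \<phi> y - \<phi> x"
    and c: "\<And>t. \<phi> (t + arccos (m + p \<bullet> dir t)) - \<phi> (t - arccos (m + p \<bullet> dir t)) = c"
    using poncelet_measure[of m p] h_pos[of a] assms(2) by (auto simp: m_def)
  have orb: "h ((F ^^ n) t) = h t" for n t by (induction n) (simp_all add: h_F)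
  have le: "(F ^^ n) a \<le> (F ^^ n) b" for n
    using assms(1) F_mono by (induction n) auto
  \<comment> \<open>The \<phi>-coordinates of the rear endpoints of the successive chords on the two
    orbits.\<close>
  define A where "A n = \<phi> ((F ^^ n) a - \<beta> ((F ^^ n) a))" for n
  define B where "B n = \<phi> ((F ^^ n) b - \<beta> ((F ^^ n) b))" for n
  have A: "A n = A 0 + real n * c" for n
  proof (induction n)
    case (Suc n)
    let ?t = "(F ^^ n) a"
    have "\<beta> ?t = arccos (m + p \<bullet> dir ?t)"
      using orb[of n a] unfolding half_width_def m_def by (simp only: flip: orb[of n a]) (simp add: h_def)
    then have "\<phi> (?t + \<beta> ?t) - \<phi> (?t - \<beta> ?t) = c" using c[of ?t] by simp
    then have "A (Suc n) = A n + c" using F[of ?t] by (simp add: A_def)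
    then show ?case using Suc by (simp add: algebra_simps)
  qed simp
  have B: "B n \<le> B 0 + real n * (c - d)" for n
  proof (induction n)
    case (Suc n)
    let ?t = "(F ^^ n) b"
    define r where "r = arccos (m + p \<bullet> dir ?t)"
    have "\<bar>m + p \<bullet> dir ?t\<bar> < 1"
      using Cauchy_Schwarz_ineq2[of p "dir ?t"] assms(2) h_pos[of a] by (simp add: m_def)
    then have "cos r = m + p \<bullet> dir ?t" unfolding r_def by (intro cos_arccos) auto
    moreover have "cos (\<beta> ?t) = m + d + p \<bullet> dir ?t"
      using orb[of n b] by (simp add: cos_half_width d_def h_def)
    ultimately have cc: "cos (\<beta> ?t) - cos r = d" by simp
    have rb: "0 \<le> r" "r \<le> pi"
      unfolding r_def using \<open>\<bar>m + p \<bullet> dir ?t\<bar> < 1\<close> by (auto intro: arccos_lbound arccos_ubound)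
    have lt: "\<beta> ?t < r"
      using cos_monotone_0_pi_le[of r "\<beta> ?t"] rb half_width_bounds[of ?t] cc \<open>d > 0\<close> by linarith
    \<comment> \<open>That is, \<open>cos\<close> is 1-Lipschitz, so a gap \<open>d\<close> in
      cosines needs a gap of at least \<open>d\<close> in angles.\<close>
    have "\<beta> ?t + cos (\<beta> ?t) \<le> r + cos r"
    proof (rule DERIV_nonneg_imp_nondecreasing, use lt in simp, intro exI conjI)
      fix u :: real
      show "((\<lambda>u. u + cos u) has_real_derivative 1 + - sin u) (at u)"
        by (auto intro!: derivative_eq_intros)
    qed simp
    then have "d \<le> r - \<beta> ?t" using cc by simp
    \<comment> \<open>The chord is shorter than the tangent chord of \<open>sphere p m\<close> by an
      angle of at least \<open>d\<close> at each end; with density at least 1/2 this costs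
      \<phi>-mass \<open>d\<close> in total.\<close>
    then have "\<phi> (?t + \<beta> ?t) - \<phi> (?t - \<beta> ?t) \<le> c - d"
      using c[of ?t] \<phi>[of "?t + \<beta> ?t" "?t + r"] \<phi>[of "?t - r" "?t - \<beta> ?t"] lt
      by (simp add: r_def[symmetric])
    then have "B (Suc n) \<le> B n + (c - d)" using F[of ?t] by (simp add: B_def)
    then show ?case using Suc by (simp add: algebra_simps)
  qed simp
  have AB: "A n \<le> B n" for n
  proof -
    have "(F ^^ n) a - \<beta> ((F ^^ n) a) \<le> (F ^^ n) b - \<beta> ((F ^^ n) b)"
      using le[of n] strict_mono_left[of "(F ^^ n) a" "(F ^^ n) b"] by (cases "(F ^^ n) a = (F ^^ n) b") auto
    then show ?thesis unfolding A_def B_def using \<phi> by fastforce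
  qed
  obtain n where "real n * d > B 0 - A 0" using \<open>d > 0\<close> reals_Archimedean3 by blast
  then show False using A[of n] B[of n] AB[of n] by (simp add: algebra_simps)
qed

lemma K_eq_cball: "\<exists>r>0. K = cball p r"
proof -
  obtain a where a: "a \<in> {0..2*pi}" "\<forall>t\<in>{0..2*pi}. h a \<le> h t"
    using continuous_attains_inf[of "{0..2*pi}" h] continuous_h by auto
  have min: "h a \<le> h t" for t
  proof -
    obtain t' where "0 \<le> t'" "t' \<le> 2 * pi" "dir t = dir t'"
      using unit_vector_dir[of "dir t"] by auto
    then show ?thesis using a(2) by (auto simp: h_def)
  qed
  \<comment> \<open>In the direction \<open>dir t\<close> of \<open>p\<close>, minimality gives
    \<open>h a \<le> h t = supp K (dir t) - norm p < 1 - norm p\<close>.\<close>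
  have small: "norm p + h a < 1"
  proof -
    obtain t where "p \<bullet> dir t = norm p"
    proof (cases "p = 0")
      case False
      then have "norm (p /\<^sub>R norm p) = 1" by simp
      then obtain t where t: "p /\<^sub>R norm p = dir t" using unit_vector_dir by blast
      have "p \<bullet> dir t = norm p"
        unfolding t[symmetric] using False by (simp add: dot_square_norm power2_eq_square)
      then show thesis by (rule that)
    qed (use that in simp)
    then show ?thesis using min[of t] abs_supp_less[of t] by (simp add: h_def)
  qed
  have const: "supp K n = h a + p \<bullet> n" if "norm n = 1" for n
  proof -
    obtain t where "n = dir t" using unit_vector_dir[OF \<open>norm n = 1\<close>] by blast
    moreover obtain t' where "a \<le> t'" "dir t' = dir t" using dir_beyond .
    ultimately show ?thesis using h_not_greater[of a t'] small min[of t'] by (auto simp: h_def)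
  qed
  have "K = cball p (h a)"
  proof (intro equalityI subsetI)
    fix y assume "y \<in> K"
    show "y \<in> cball p (h a)"
    proof (cases "y = p")
      case False
      define n where "n = (y - p) /\<^sub>R norm (y - p)"
      have "norm n = 1" using False by (simp add: n_def)
      then have "(y - p) \<bullet> n \<le> h a"
        using supp_upper[OF \<open>y \<in> K\<close>, of n] const[of n] by (simp add: inner_diff_left)
      moreover have "(y - p) \<bullet> n = norm (y - p)"
        using False by (simp add: n_def dot_square_norm power2_eq_square)
      ultimately show ?thesis by (simp add: dist_norm norm_minus_commute)
    qed (use h_pos[of a] in simp)
  next
    fix z assume z: "z \<in> cball p (h a)"
    show "z \<in> K"
    proof (rule ccontr)
      assume "z \<notin> K"
      \<comment> \<open>The outward normal of a line separating \<open>z\<close> from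
        \<open>K\<close> is a direction in which \<open>z\<close> exceeds the support
        function.\<close>
      then obtain v b where v: "v \<bullet> z < b" "\<forall>y\<in>K. v \<bullet> y > b"
        using separating_hyperplane_closed_point[OF convex_K compact_imp_closed[OF compact_K]] by blast
      have "v \<noteq> 0" using v nonempty_K by force
      define n where "n = - (v /\<^sub>R norm v)"
      have nn: "norm n = 1" using \<open>v \<noteq> 0\<close> by (simp add: n_def)
      obtain y where y: "y \<in> K" "y \<bullet> n = supp K n" using support_point .
      have "v \<bullet> z < v \<bullet> y" using v y by fastforce
      then have "y \<bullet> n < z \<bullet> n" using \<open>v \<noteq> 0\<close> by (simp add: n_def inner_commute)
      moreover have "(z - p) \<bullet> n \<le> h a"
        using Cauchy_Schwarz_ineq2[of "z - p" n] nn z by (simp add: dist_norm norm_minus_commute)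
      ultimately show False using y const[OF nn] by (simp add: inner_diff_left)
    qed
  qed
  then show ?thesis using h_pos by blast
qed

end

theorem theorem1:
  fixes K :: "(real^2) set" and p :: "real^2"
  assumes "convex_body K"
    and "K \<subseteq> interior (cball 0 1)"
    and "\<And>x. x \<in> sphere 0 1 \<Longrightarrow> p \<in> angle_bisector K x"
  shows "\<exists>r>0. K = cball p r"
proof -
  interpret bisected_body K p
    by unfold_locales (use assms in auto)
  show ?thesis by (rule K_eq_cball)
qed

end
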